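(* Let $(E,d_E)$ be a complete separable metric space with Borel $\sigma$-algebra $\mathcal E$. (1) Let $\mu$ be a probability measure on $(E,\mathcal E)$ and let $\Phi,\widetilde\Phi\in L^1_\mu(\mathbb R)$ with $\operatorname{ess\,inf}_\mu\Phi=0$. Put $Z:=\int_E e^{-\Phi}\,d\mu$ and $\widetilde Z:=\int_E e^{-\widetilde\Phi}\,d\mu$ (both in $(0,\infty)$), and define the probability measures $\mu_\Phi(dx):=\frac1Z e^{-\Phi(x)}\mu(dx)$ and $\mu_{\widetilde\Phi}(dx):=\frac1{\widetilde Z}e^{-\widetilde\Phi(x)}\mu(dx)$. Then $$d_{\mathrm{TV}}(\mu_\Phi,\mu_{\widetilde\Phi})\le\frac{\exp\left(-[\operatorname{ess\,inf}_\mu\widetilde\Phi]_-\right)}{Z}\,\|\Phi-\widetilde\Phi\|_{L^1_\mu}.$$ (2) Let $\mu,\widetilde\mu$ be probability measures on $(E,\mathcal E)$ and let $\Phi\colon E\to[0,\infty)$ be measurable. Put $Z:=\int_E e^{-\Phi}\,d\mu$, $\widetilde Z:=\int_E e^{-\Phi}\,d\widetilde\mu$, and define the probability measures $\mu_\Phi(dx):=\frac1Z e^{-\Phi(x)}\mu(dx)$ and $\widetilde\mu_\Phi(dx):=\frac1{\widetilde Z}e^{-\Phi(x)}\widetilde\mu(dx)$. Then $$d_{\mathrm{TV}}(\mu_\Phi,\widetilde\mu_\Phi)\le\frac2Z\,d_{\mathrm{TV}}(\mu,\widetilde\mu).$$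
   Context: $[t]_-:=\min(0,t)$. The total variation distance is $d_{\mathrm{TV}}(\mu,\widetilde\mu):=\sup_{A\in\mathcal E}|\mu(A)-\widetilde\mu(A)|=\frac12\int_E\left|\frac{d\mu}{d\nu}-\frac{d\widetilde\mu}{d\nu}\right|d\nu$ for any $\nu$ dominating both measures. $L^1_\mu(\mathbb R)$ is the space of $\mu$-integrable real functions with norm $\|\cdot\|_{L^1_\mu}$. If $\operatorname{ess\,inf}_\mu\widetilde\Phi=-\infty$ the right-hand side in (1) is read as $+\infty$. *)

theory Defs
  imports "HOL-Probability.Probability"
begin

text \<open>Extended-real valued, so that functions that are essentially unbounded below have
  essential infimum \<open>-\<infinity>\<close>.\<close>

definition essinf :: "'a measure \<Rightarrow> ('a \<Rightarrow> real) \<Rightarrow> ereal" where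
  "essinf M f = - esssup M (\<lambda>x. - ereal (f x))"

definition exp_ereal :: "ereal \<Rightarrow> ennreal" where
  "exp_ereal t = (case t of ereal r \<Rightarrow> ennreal (exp r) | PInfty \<Rightarrow> \<infinity> | MInfty \<Rightarrow> 0)"

text \<open>Meant for probability measures on the same \<open>\<sigma>\<close>-algebra; the supremum is then over a
  nonempty bounded set of reals.\<close>

definition tv_dist :: "'a measure \<Rightarrow> 'a measure \<Rightarrow> real" where
  "tv_dist M N = (SUP A\<in>sets M. \<bar>measure M A - measure N A\<bar>)"

definition normalizer :: "'a measure \<Rightarrow> ('a \<Rightarrow> real) \<Rightarrow> ennreal" where
  "normalizer M \<Phi> = (\<integral>\<^sup>+ x. ennreal (exp (- \<Phi> x)) \<partial>M)"

text \<open>Only meaningful if the normalizer lies strictly between \<open>0\<close> and \<open>\<infinity>\<close>.\<close>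

definition gibbs :: "'a measure \<Rightarrow> ('a \<Rightarrow> real) \<Rightarrow> 'a measure" where
  "gibbs M \<Phi> = density M (\<lambda>x. ennreal (exp (- \<Phi> x)) / normalizer M \<Phi>)"

end

theory Submission
  imports Defs
begin

text \<open>For finite measures \<open>a\<close>, \<open>b\<close> with total masses \<open>Z\<close>, \<open>Z'\<close>, put \<open>p = b(A)/Z'\<close>. Then
  \<open>Z (a(A)/Z - b(A)/Z') = (1 - p) (a(A) - b(A)) - p (a(A\<^sup>c) - b(A\<^sup>c))\<close>, so normalizing costs only a
  factor \<open>1/Z\<close>. It remains to compare the unnormalized measures: in the first part by
  \<open>\<bar>exp(-x) - exp(-y)\<bar> \<le> exp(-m) \<bar>x - y\<bar>\<close> for \<open>x, y \<ge> m\<close>, in the second part because integrals of a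
  function with values in \<open>[0,1]\<close> differ by at most the total variation distance, as one sees by
  integrating over its superlevel sets.\<close>

section \<open>Two elementary inequalities on real numbers\<close>

lemma abs_normalized_diff_le:
  fixes a a' b b' :: real
  assumes "0 \<le> b" "0 \<le> b'" "0 < a + a'" "0 < b + b'"
  shows "\<bar>a / (a + a') - b / (b + b')\<bar> \<le> (\<bar>a - b\<bar> + \<bar>a' - b'\<bar>) / (a + a')"
proof -
  define p where "p = b / (b + b')"
  have p: "0 \<le> p" "p \<le> 1" "p * (b + b') = b"
    using assms by (auto simp: p_def)
  have "a - p * (a + a') = (1 - p) * (a - b) - p * (a' - b') + (b - p * (b + b'))"
    by (simp add: algebra_simps)
  then have "\<bar>a - p * (a + a')\<bar> = \<bar>(1 - p) * (a - b) - p * (a' - b')\<bar>"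
    using p by simp
  also have "\<dots> \<le> (1 - p) * \<bar>a - b\<bar> + p * \<bar>a' - b'\<bar>"
    using p abs_triangle_ineq4[of "(1 - p) * (a - b)" "p * (a' - b')"] by (simp add: abs_mult)
  also have "\<dots> \<le> \<bar>a - b\<bar> + \<bar>a' - b'\<bar>"
    using p by (intro add_mono mult_left_le_one_le) auto
  finally have "\<bar>a - p * (a + a')\<bar> / (a + a') \<le> (\<bar>a - b\<bar> + \<bar>a' - b'\<bar>) / (a + a')"
    using assms by (intro divide_right_mono) auto
  moreover have "a / (a + a') - b / (b + b') = (a - p * (a + a')) / (a + a')"
    using assms by (simp add: p_def diff_divide_distrib)
  ultimately show ?thesis
    using assms by (simp add: abs_divide)
qed

text \<open>For \<open>u \<le> v\<close>, factor out \<open>exp (- u)\<close>, which is at most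
  \<open>exp (- m)\<close>, and use \<open>1 - exp (- s) \<le> s\<close> with
  \<open>s = v - u\<close>. Allowing a common lower bound \<open>m\<close> other than zero is what
  produces the factor with the essential infimum in the first bound.\<close>

lemma exp_minus_diff_le:
  fixes x y m :: real
  assumes "m \<le> x" "m \<le> y"
  shows "\<bar>exp (- x) - exp (- y)\<bar> \<le> exp (- m) * \<bar>x - y\<bar>"
proof -
  have *: "exp (- u) - exp (- v) \<le> exp (- m) * (v - u)" if "m \<le> u" "u \<le> v" for u v :: real
  proof -
    have "exp (- u) - exp (- v) = exp (- u) * (1 - exp (- (v - u)))"
      by (simp add: algebra_simps flip: exp_add)
    also have "\<dots> \<le> exp (- m) * (v - u)"
      using that exp_ge_add_one_self[of "u - v"] by (intro mult_mono) (auto simp: algebra_simps)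
    finally show ?thesis .
  qed
  have "exp (- max x y) \<le> exp (- min x y)"
    by simp
  then show ?thesis
    using *[of x y] *[of y x] assms by (cases "x \<le> y") (auto simp: abs_if)
qed

section \<open>Normalizers and Gibbs measures over a probability space\<close>

context prob_space
begin

text \<open>A vanishing integral would force the strictly positive integrand to be zero almost
  everywhere, which is impossible for a probability measure.\<close>

lemma normalizer_pos:
  assumes [measurable]: "f \<in> borel_measurable M"
  shows "0 < normalizer M f"
proof -
  have "normalizer M f \<noteq> 0"
    unfolding normalizer_def by (subst nn_integral_0_iff_AE) auto
  then show ?thesis by (simp add: zero_less_iff_neq_zero)
qed

lemma normalizer_finite:
  assumes "AE x in M. m \<le> f x"
  shows "normalizer M f < \<infinity>"
proof -
  have "normalizer M f \<le> (\<integral>\<^sup>+ x. ennreal (exp (- m)) \<partial>M)"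
    unfolding normalizer_def using assms by (intro nn_integral_mono_AE) (auto simp: ennreal_leI)
  then show ?thesis
    by (simp add: emeasure_space_1 le_less_trans)
qed

text \<open>This is the passage from \<open>ennreal\<close> to real integrals. The hypothesis is a
  finite normalizer rather than a lower bound on the potential, so potentials that are essentially
  unbounded below are covered as well.\<close>

lemma
  assumes [measurable]: "f \<in> borel_measurable M" and fin: "normalizer M f < \<infinity>"
  shows integrable_exp_minus: "integrable M (\<lambda>x. exp (- f x))"
    and normalizer_eq: "normalizer M f = ennreal (\<integral>x. exp (- f x) \<partial>M)"
    and integral_exp_minus_pos: "0 < (\<integral>x. exp (- f x) \<partial>M)"
proof -
  show i: "integrable M (\<lambda>x. exp (- f x))"
    using fin by (intro integrableI_nonneg) (auto simp: normalizer_def)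
  then show eq: "normalizer M f = ennreal (\<integral>x. exp (- f x) \<partial>M)"
    unfolding normalizer_def by (intro nn_integral_eq_integral) auto
  show "0 < (\<integral>x. exp (- f x) \<partial>M)"
    using normalizer_pos[of f] by (simp add: eq)
qed

lemma prob_space_gibbs:
  assumes [measurable]: "f \<in> borel_measurable M" and fin: "normalizer M f < \<infinity>"
  shows "prob_space (gibbs M f)"
proof
  have "emeasure (gibbs M f) (space M) = (\<integral>\<^sup>+x. ennreal (exp (- f x)) / normalizer M f \<partial>M)"
    unfolding gibbs_def by (simp add: emeasure_density cong: nn_integral_cong)
  also have "\<dots> = normalizer M f / normalizer M f"
    by (simp add: nn_integral_divide normalizer_def)
  also have "\<dots> = 1"
    using fin normalizer_pos[of f] by (intro ennreal_divide_self) auto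
  finally show "emeasure (gibbs M f) (space (gibbs M f)) = 1"
    by (simp add: gibbs_def)
qed

text \<open>Probabilities become quotients of real integrals here, the form to which
  \<open>abs_normalized_diff_le\<close> applies.\<close>

lemma measure_gibbs:
  assumes [measurable]: "f \<in> borel_measurable M" "A \<in> sets M" and fin: "normalizer M f < \<infinity>"
  shows "measure (gibbs M f) A = (LINT x:A|M. exp (- f x)) / (\<integral>x. exp (- f x) \<partial>M)"
proof -
  have i: "set_integrable M A (\<lambda>x. exp (- f x))"
    unfolding set_integrable_def
    using integrable_exp_minus[OF _ fin] by (intro integrable_mult_indicator) auto
  have "emeasure (gibbs M f) A
      = (\<integral>\<^sup>+x. ennreal (indicator A x * exp (- f x)) / normalizer M f \<partial>M)"
    unfolding gibbs_def
    by (auto simp: emeasure_density indicator_def intro!: nn_integral_cong)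
  also have "\<dots> = (\<integral>\<^sup>+x. ennreal (indicator A x * exp (- f x)) \<partial>M) / normalizer M f"
    by (intro nn_integral_divide) simp
  also have "(\<integral>\<^sup>+x. ennreal (indicator A x * exp (- f x)) \<partial>M)
      = ennreal (LINT x:A|M. exp (- f x))"
    using i unfolding set_integrable_def set_lebesgue_integral_def
    by (subst nn_integral_eq_integral) auto
  finally have "emeasure (gibbs M f) A
      = ennreal ((LINT x:A|M. exp (- f x)) / (\<integral>x. exp (- f x) \<partial>M))"
    using integral_exp_minus_pos[OF _ fin]
    by (simp add: normalizer_eq[OF _ fin] divide_ennreal set_lebesgue_integral_def)
  then show ?thesis
    using integral_exp_minus_pos[OF _ fin]
    by (simp add: measure_def set_lebesgue_integral_def)
qed

end

section \<open>Reduction to unnormalized measures\<close>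

text \<open>Base measure and potential may both change, so both bounds of the theorem are instances.
  The errors on \<open>A\<close> and on its complement are bounded jointly by \<open>c\<close>: for
  a change of potential they add up to a single integral over the whole space, and bounding them
  separately would lose a factor 2.\<close>

lemma tv_dist_gibbs_le:
  assumes "prob_space M" "prob_space N" and sets: "sets M = sets N"
    and [measurable]: "f \<in> borel_measurable M" "g \<in> borel_measurable N"
    and fin: "normalizer M f < \<infinity>" "normalizer N g < \<infinity>"
    and le: "\<And>A. A \<in> sets M \<Longrightarrow>
      \<bar>(LINT x:A|M. exp (- f x)) - (LINT x:A|N. exp (- g x))\<bar>
      + \<bar>(LINT x:space M - A|M. exp (- f x)) - (LINT x:space M - A|N. exp (- g x))\<bar> \<le> c"
  shows "ennreal (tv_dist (gibbs M f) (gibbs N g)) \<le> ennreal c / normalizer M f"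
proof -
  interpret M: prob_space M by fact
  interpret N: prob_space N by fact
  note [simp] = sets_eq_imp_space_eq[OF sets]
  have split: "(\<integral>x. exp (- h x) \<partial>K) = (LINT x:A|K. exp (- h x)) + (LINT x:space K - A|K. exp (- h x))"
    if "integrable K (\<lambda>x. exp (- h x))" "A \<in> sets K" for h A and K :: "'a measure"
  proof -
    have "(\<integral>x. exp (- h x) \<partial>K) =
        (\<integral>x. indicator A x *\<^sub>R exp (- h x) + indicator (space K - A) x *\<^sub>R exp (- h x) \<partial>K)"
      by (intro Bochner_Integration.integral_cong) (auto simp: indicator_def)
    also have "\<dots> = (LINT x:A|K. exp (- h x)) + (LINT x:space K - A|K. exp (- h x))"
      unfolding set_lebesgue_integral_def using that
      by (intro Bochner_Integration.integral_add integrable_mult_indicator) auto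
    finally show ?thesis .
  qed
  define Z where "Z = (\<integral>x. exp (- f x) \<partial>M)"
  have Z: "0 < Z" unfolding Z_def using fin by (intro M.integral_exp_minus_pos) auto
  have Z': "0 < (\<integral>x. exp (- g x) \<partial>N)" using fin by (intro N.integral_exp_minus_pos) auto
  have "\<bar>measure (gibbs M f) A - measure (gibbs N g) A\<bar> \<le> c / Z"
    if A: "A \<in> sets M" for A
  proof -
    let ?a = "LINT x:A|M. exp (- f x)" and ?a' = "LINT x:space M - A|M. exp (- f x)"
    let ?b = "LINT x:A|N. exp (- g x)" and ?b' = "LINT x:space M - A|N. exp (- g x)"
    have 1: "Z = ?a + ?a'"
      unfolding Z_def using A fin by (intro split M.integrable_exp_minus) auto
    have 2: "(\<integral>x. exp (- g x) \<partial>N) = ?b + ?b'"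
      using A fin split[of N g A] N.integrable_exp_minus[of g] by (auto simp: sets)
    have "0 \<le> ?b" "0 \<le> ?b'"
      by (auto simp: set_lebesgue_integral_def)
    then have "\<bar>?a / (?a + ?a') - ?b / (?b + ?b')\<bar> \<le> (\<bar>?a - ?b\<bar> + \<bar>?a' - ?b'\<bar>) / (?a + ?a')"
      using Z Z' 1 2 by (intro abs_normalized_diff_le) auto
    also have "\<dots> \<le> c / (?a + ?a')"
      using le[OF A] Z 1 by (intro divide_right_mono) auto
    finally show ?thesis
      using M.measure_gibbs[of f A] N.measure_gibbs[of g A] A fin 1 2
      by (simp add: sets Z_def)
  qed
  then have "tv_dist (gibbs M f) (gibbs N g) \<le> c / Z"
    unfolding tv_dist_def by (intro cSUP_least) (auto simp: gibbs_def)
  \<comment> \<open>The hypothesis for the empty set bounds a nonnegative number by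
    \<open>c\<close>. With this sign, the real quotient \<open>c / Z\<close> can be read as a
    quotient in \<open>ennreal\<close>.\<close>
  moreover have "0 \<le> c"
    using le[of "{}"] by simp
  ultimately show ?thesis
    using Z M.normalizer_eq[of f] fin by (simp add: divide_ennreal Z_def[symmetric])
qed

section \<open>Total variation distance and integrals of functions with values in [0,1]\<close>

lemma abs_measure_diff_le_tv_dist:
  assumes "prob_space M" "prob_space N" "A \<in> sets M"
  shows "\<bar>measure M A - measure N A\<bar> \<le> tv_dist M N"
proof -
  interpret M: prob_space M by fact
  interpret N: prob_space N by fact
  \<comment> \<open>The supremum is taken in the reals, so it dominates its members only once the
    family is known to be bounded above.\<close>
  have "\<bar>measure M A - measure N A\<bar> \<le> 1" for A
    using M.prob_le_1[of A] N.prob_le_1[of A]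
    by (smt (verit) measure_nonneg)
  then show ?thesis
    unfolding tv_dist_def using assms(3) by (intro cSUP_upper bdd_aboveI2[of _ _ 1]) auto
qed

text \<open>Layer-cake formula: \<open>f x\<close> is the length of the interval from 0 to
  \<open>f x\<close>, and Tonelli exchanges the integrals over \<open>x\<close> and the level
  \<open>t\<close>. Since \<open>f \<le> 1\<close>, levels in \<open>{0..<1}\<close> suffice, a
  range of length one.\<close>

lemma (in sigma_finite_measure) nn_integral_eq_superlevel:
  fixes f :: "'a \<Rightarrow> real"
  assumes [measurable]: "f \<in> borel_measurable M"
    and f: "\<And>x. x \<in> space M \<Longrightarrow> 0 \<le> f x" "\<And>x. x \<in> space M \<Longrightarrow> f x \<le> 1"
  shows "(\<integral>\<^sup>+x. ennreal (f x) \<partial>M)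
    = (\<integral>\<^sup>+t. indicator {0..<1} t * emeasure M {x\<in>space M. t < f x} \<partial>lborel)"
proof -
  interpret pair_sigma_finite M "lborel :: real measure" ..
  have "(\<integral>\<^sup>+x. ennreal (f x) \<partial>M)
      = (\<integral>\<^sup>+x. \<integral>\<^sup>+t. indicator {0..<1} t * indicator {x\<in>space M. t < f x} x \<partial>lborel \<partial>M)"
  proof (intro nn_integral_cong)
    fix x assume x: "x \<in> space M"
    have "(\<integral>\<^sup>+t. indicator {0..<1} t * indicator {x\<in>space M. t < f x} x \<partial>lborel)
        = (\<integral>\<^sup>+t. indicator {0..<f x} t \<partial>lborel)"
      using x f[OF x] by (intro nn_integral_cong) (auto simp: indicator_def)
    then show "ennreal (f x)
        = (\<integral>\<^sup>+t. indicator {0..<1} t * indicator {x\<in>space M. t < f x} x \<partial>lborel)"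
      using f[OF x] by simp
  qed
  also have "\<dots> = (\<integral>\<^sup>+t. \<integral>\<^sup>+x. indicator {0..<1} t * indicator {x\<in>space M. t < f x} x \<partial>M \<partial>lborel)"
    by (rule Fubini'[symmetric]) measurable
  also have "\<dots> = (\<integral>\<^sup>+t. indicator {0..<1} t * emeasure M {x\<in>space M. t < f x} \<partial>lborel)"
    by (intro nn_integral_cong) (simp add: nn_integral_cmult)
  finally show ?thesis .
qed

text \<open>The superlevel sets of \<open>f\<close> are measurable, so the bound \<open>d\<close>
  holds at every level and can be integrated over the levels. The statement is one-sided; exchanging
  the measures gives the other side.\<close>

lemma integral_diff_le:
  fixes f :: "'a \<Rightarrow> real"
  assumes M: "prob_space M" and N: "prob_space N" and sets: "sets M = sets N"
    and [measurable]: "f \<in> borel_measurable M"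
    and f: "\<And>x. x \<in> space M \<Longrightarrow> 0 \<le> f x" "\<And>x. x \<in> space M \<Longrightarrow> f x \<le> 1"
    and le: "\<And>A. A \<in> sets M \<Longrightarrow> measure M A - measure N A \<le> d" and d: "0 \<le> d"
  shows "(\<integral>x. f x \<partial>M) - (\<integral>x. f x \<partial>N) \<le> d"
proof -
  interpret M: prob_space M by fact
  interpret N: prob_space N by fact
  note space = sets_eq_imp_space_eq[OF sets]
  have [measurable]: "f \<in> borel_measurable N"
    by (simp add: measurable_cong_sets[OF sets[symmetric] refl])
  have "integrable M f"
    using f by (intro M.integrable_const_bound[of _ 1]) auto
  then have iM: "(\<integral>\<^sup>+x. ennreal (f x) \<partial>M) = ennreal (\<integral>x. f x \<partial>M)"
    using f by (intro nn_integral_eq_integral) auto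
  have "integrable N f"
    using f by (intro N.integrable_const_bound[of _ 1]) (auto simp: space)
  then have iN: "(\<integral>\<^sup>+x. ennreal (f x) \<partial>N) = ennreal (\<integral>x. f x \<partial>N)"
    using f by (intro nn_integral_eq_integral) (auto simp: space)
  \<comment> \<open>The bound is put in additive form to avoid truncated subtraction in
    \<open>ennreal\<close>.\<close>
  have "emeasure M {x\<in>space M. t < f x} \<le> emeasure N {x\<in>space N. t < f x} + ennreal d" for t
    using le[of "{x\<in>space M. t < f x}", simplified] d
    by (auto simp: M.emeasure_eq_measure N.emeasure_eq_measure space simp flip: ennreal_plus
        intro!: ennreal_leI)
  then have "(\<integral>\<^sup>+x. ennreal (f x) \<partial>M) \<le>
      (\<integral>\<^sup>+t. indicator {0..<1} t * (emeasure N {x\<in>space N. t < f x} + ennreal d) \<partial>lborel)"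
    by (subst M.nn_integral_eq_superlevel) (auto intro!: nn_integral_mono mult_left_mono simp: f)
  also have "\<dots> = (\<integral>\<^sup>+t. indicator {0..<1} t * emeasure N {x\<in>space N. t < f x} \<partial>lborel)
      + (\<integral>\<^sup>+t. ennreal d * indicator {0..<1::real} t \<partial>lborel)"
    by (subst nn_integral_add[symmetric]) (auto simp: algebra_simps)
  \<comment> \<open>The levels range over an interval of length one, so the constant contributes
    exactly \<open>d\<close>.\<close>
  also have "\<dots> = ennreal (\<integral>x. f x \<partial>N) + ennreal d"
    using f by (subst N.nn_integral_eq_superlevel[symmetric])
      (auto simp: space iN nn_integral_cmult)
  also have "\<dots> = ennreal ((\<integral>x. f x \<partial>N) + d)"
    using d f by (intro ennreal_plus[symmetric] integral_nonneg_AE) (auto simp: space)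
  finally have "ennreal (\<integral>x. f x \<partial>M) \<le> ennreal ((\<integral>x. f x \<partial>N) + d)"
    by (simp add: iM)
  moreover have "0 \<le> (\<integral>x. f x \<partial>N)"
    using f by (intro integral_nonneg_AE) (auto simp: space)
  ultimately show ?thesis
    using d ennreal_le_iff[of "(\<integral>x. f x \<partial>N) + d" "\<integral>x. f x \<partial>M"] by linarith
qed

section \<open>Essential infima\<close>

lemma essinf_AE: "AE x in M. essinf M f \<le> ereal (f x)"
  using esssup_AE[of "\<lambda>x. - ereal (f x)" M]
  by (auto simp: essinf_def ereal_uminus_le_reorder elim!: eventually_mono)

text \<open>The minimum with 0 excludes the value \<infinity>, so excluding -\<infinity> is enough
  to obtain a real number. It is a lower bound almost everywhere because it does not exceed the
  essential infimum.\<close>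

lemma min_essinf_finite:
  assumes "essinf M f \<noteq> -\<infinity>"
  obtains m where "min 0 (essinf M f) = ereal m" "m \<le> 0" "AE x in M. m \<le> f x"
proof -
  obtain m where m: "min 0 (essinf M f) = ereal m"
    using assms by (cases "min 0 (essinf M f)") (auto simp: min_def split: if_splits)
  have "ereal m \<le> 0" "ereal m \<le> essinf M f"
    by (simp_all flip: m)
  moreover have "AE x in M. m \<le> f x"
    using essinf_AE[of M f]
    by eventually_elim (metis \<open>ereal m \<le> essinf M f\<close> ereal_less_eq(3) order_trans)
  ultimately show ?thesis
    using m that by simp
qed

text \<open>Serves the case of a perturbed potential that is essentially unbounded below, where it
  rules out a vanishing distance between the potentials.\<close>

lemma essinf_AE_cong:
  assumes "f \<in> borel_measurable M" "g \<in> borel_measurable M" "AE x in M. f x = g x"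
  shows "essinf M f = essinf M g"
  unfolding essinf_def using assms by (auto intro!: arg_cong[where f=uminus] esssup_AE_cong)

section \<open>Perturbation of the potential\<close>

lemma tv_dist_gibbs_potential:
  assumes M: "prob_space M" and f: "integrable M f" and g: "integrable M g"
    and ess: "essinf M f = 0" and fin: "normalizer M g < \<infinity>"
  shows "ennreal (tv_dist (gibbs M f) (gibbs M g))
    \<le> exp_ereal (- min 0 (essinf M g)) / normalizer M f * ennreal (\<integral>x. \<bar>f x - g x\<bar> \<partial>M)"
proof -
  interpret prob_space M by fact
  have [measurable]: "f \<in> borel_measurable M" "g \<in> borel_measurable M"
    using f g by auto
  have f_nonneg: "AE x in M. 0 \<le> f x"
    using essinf_AE[of M f] by (simp add: ess)
  then have fin': "normalizer M f < \<infinity>"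
    by (rule normalizer_finite)
  have int: "integrable M (\<lambda>x. \<bar>f x - g x\<bar>)"
    using f g by auto
  show ?thesis
  proof (cases "essinf M g = -\<infinity>")
    case True
    \<comment> \<open>The exponential factor is \<infinity> here, but \<infinity> times 0 is 0 in
      \<open>ennreal\<close>, so the right-hand side is infinite only if the distance is nonzero. At
      distance zero, \<open>f\<close> and \<open>g\<close> would agree almost everywhere, yet their
      essential infima are 0 and -\<infinity>.\<close>
    have "(\<integral>x. \<bar>f x - g x\<bar> \<partial>M) \<noteq> 0"
    proof
      assume "(\<integral>x. \<bar>f x - g x\<bar> \<partial>M) = 0"
      then have "AE x in M. f x = g x"
        using integral_nonneg_eq_0_iff_AE[OF int] by simp
      then show False
        using essinf_AE_cong[of f M g] True ess by simp
    qed
    then have "0 < (\<integral>x. \<bar>f x - g x\<bar> \<partial>M)"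
      by (simp add: less_le)
    then show ?thesis
      using True fin' by (simp add: exp_ereal_def ennreal_top_divide ennreal_top_mult min_def)
  next
    case False
    then obtain m where m: "min 0 (essinf M g) = ereal m" "m \<le> 0" and m_le: "AE x in M. m \<le> g x"
      by (rule min_essinf_finite)
    \<comment> \<open>Capping at 0 makes \<open>m\<close> a common lower bound:
      \<open>m \<le> 0 \<le> f x\<close> almost everywhere.\<close>
    have ge: "AE x in M. m \<le> f x" "AE x in M. m \<le> g x"
      using f_nonneg m m_le by (auto elim!: eventually_mono)
    note intf = integrable_exp_minus[OF _ fin'] and intg = integrable_exp_minus[OF _ fin]
    let ?d = "\<lambda>x. exp (- f x) - exp (- g x)"
    have intd: "integrable M ?d"
      using intf intg by auto
    have le: "\<bar>(LINT x:A|M. exp (- f x)) - (LINT x:A|M. exp (- g x))\<bar>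
        + \<bar>(LINT x:space M - A|M. exp (- f x)) - (LINT x:space M - A|M. exp (- g x))\<bar>
        \<le> exp (- m) * (\<integral>x. \<bar>f x - g x\<bar> \<partial>M)" if [measurable]: "A \<in> sets M" for A
    proof -
      have *: "\<bar>(LINT x:B|M. exp (- f x)) - (LINT x:B|M. exp (- g x))\<bar>
          \<le> (\<integral>x. indicator B x * \<bar>?d x\<bar> \<partial>M)" if [measurable]: "B \<in> sets M" for B
      proof -
        have "(LINT x:B|M. exp (- f x)) - (LINT x:B|M. exp (- g x)) = (LINT x:B|M. ?d x)"
          using intf intg by (intro set_integral_diff(2)[symmetric])
            (auto simp: set_integrable_def intro!: integrable_mult_indicator[where 'b=real, simplified])
        also have "\<bar>\<dots>\<bar> \<le> (\<integral>x. \<bar>indicator B x * ?d x\<bar> \<partial>M)"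
          unfolding set_lebesgue_integral_def real_scaleR_def by (rule integral_abs_bound)
        finally show ?thesis by (simp add: abs_mult)
      qed
      have i: "integrable M (\<lambda>x. indicator B x * \<bar>?d x\<bar>)" if "B \<in> sets M" for B
        using integrable_mult_indicator[OF that integrable_abs[OF intd]] by simp
      have "\<bar>(LINT x:A|M. exp (- f x)) - (LINT x:A|M. exp (- g x))\<bar>
          + \<bar>(LINT x:space M - A|M. exp (- f x)) - (LINT x:space M - A|M. exp (- g x))\<bar>
          \<le> (\<integral>x. indicator A x * \<bar>?d x\<bar> + indicator (space M - A) x * \<bar>?d x\<bar> \<partial>M)"
        using *[of A] *[of "space M - A"] i[of A] i[of "space M - A"] by simp
      \<comment> \<open>The indicators of \<open>A\<close> and its complement sum to one on the
        space, so the two errors merge without a factor 2.\<close>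
      also have "\<dots> = (\<integral>x. \<bar>?d x\<bar> \<partial>M)"
        by (intro Bochner_Integration.integral_cong) (auto simp: indicator_def)
      also have "\<dots> \<le> (\<integral>x. exp (- m) * \<bar>f x - g x\<bar> \<partial>M)"
        using ge intd int
        by (intro integral_mono_AE) (auto elim!: eventually_elim2 intro!: exp_minus_diff_le)
      finally show ?thesis by simp
    qed
    have "ennreal (tv_dist (gibbs M f) (gibbs M g))
        \<le> ennreal (exp (- m) * (\<integral>x. \<bar>f x - g x\<bar> \<partial>M)) / normalizer M f"
      using le fin fin' by (intro tv_dist_gibbs_le M) auto
    also have "\<dots> = ennreal (exp (- m)) / normalizer M f * ennreal (\<integral>x. \<bar>f x - g x\<bar> \<partial>M)"
      by (simp add: ennreal_mult divide_ennreal_def mult_ac)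
    finally show ?thesis
      by (simp add: m exp_ereal_def)
  qed
qed

section \<open>Perturbation of the base measure\<close>

lemma tv_dist_gibbs_prior:
  assumes M: "prob_space M" and N: "prob_space N" and sets: "sets M = sets N"
    and f[measurable]: "f \<in> borel_measurable M" and nonneg: "\<And>x. x \<in> space M \<Longrightarrow> 0 \<le> f x"
  shows "ennreal (tv_dist (gibbs M f) (gibbs N f)) \<le> 2 / normalizer M f * ennreal (tv_dist M N)"
proof -
  interpret M: prob_space M by fact
  interpret N: prob_space N by fact
  note space = sets_eq_imp_space_eq[OF sets]
  have f'[measurable]: "f \<in> borel_measurable N"
    by (simp add: measurable_cong_sets[OF sets[symmetric] refl])
  note tv = abs_measure_diff_le_tv_dist[OF M N]
  have tv_nonneg: "0 \<le> tv_dist M N"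
    using tv[of "{}"] by simp
  have *: "\<bar>(LINT x:A|M. exp (- f x)) - (LINT x:A|N. exp (- f x))\<bar> \<le> tv_dist M N"
    if A[measurable]: "A \<in> sets M" for A
  proof -
    \<comment> \<open>As \<open>f\<close> is nonnegative, this integrand takes values in [0,1], so
      \<open>integral_diff_le\<close> applies to it.\<close>
    let ?h = "\<lambda>x. indicator A x * exp (- f x)"
    have h: "0 \<le> ?h x" "x \<in> space M \<Longrightarrow> ?h x \<le> 1" for x
      using nonneg by (auto simp: indicator_def)
    have A': "A \<in> sets N" using A sets by simp
    have "(\<integral>x. ?h x \<partial>M) - (\<integral>x. ?h x \<partial>N) \<le> tv_dist M N"
      using h tv tv_nonneg by (intro integral_diff_le M N sets) (auto simp: abs_le_iff)
    \<comment> \<open>The same number serves with the measures exchanged, because \<open>tv\<close>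
      bounds the absolute difference on each set.\<close>
    moreover have "(\<integral>x. ?h x \<partial>N) - (\<integral>x. ?h x \<partial>M) \<le> tv_dist M N"
      using h tv tv_nonneg A' f'
      by (intro integral_diff_le M N sets[symmetric]) (auto simp: abs_le_iff sets space)
    ultimately show ?thesis
      by (simp add: set_lebesgue_integral_def)
  qed
  have fin: "normalizer M f < \<infinity>" "normalizer N f < \<infinity>"
    using M.normalizer_finite[of 0 f, OF AE_I2] N.normalizer_finite[of 0 f, OF AE_I2]
    by (simp_all add: nonneg space)
  \<comment> \<open>The factor 2 of the second bound arises here: \<open>A\<close> and its
    complement each cost one total variation distance.\<close>
  have **: "\<bar>(LINT x:A|M. exp (- f x)) - (LINT x:A|N. exp (- f x))\<bar>
      + \<bar>(LINT x:space M - A|M. exp (- f x)) - (LINT x:space M - A|N. exp (- f x))\<bar>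
      \<le> 2 * tv_dist M N" if "A \<in> sets M" for A
    using *[OF that] *[OF sets.compl_sets[OF that]] by linarith
  have "ennreal (tv_dist (gibbs M f) (gibbs N f)) \<le> ennreal (2 * tv_dist M N) / normalizer M f"
    by (rule tv_dist_gibbs_le[OF M N sets f f' fin **])
  also have "\<dots> = 2 / normalizer M f * ennreal (tv_dist M N)"
    using tv_nonneg by (simp add: ennreal_mult divide_ennreal_def mult_ac)
  finally show ?thesis .
qed

section \<open>Both stability bounds on a Polish space\<close>

text \<open>Integrability of \<Phi>' alone does not make the integral of its negative exponential
  finite. Finiteness is therefore derived when the essential infimum is not -\<infinity>, and is
  otherwise a premise for the Gibbs measure of \<Phi>' to make sense.\<close>

theorem theorem8:
  shows "(\<forall>(\<mu> :: 'a::polish_space measure) (\<Phi> :: 'a \<Rightarrow> real) (\<Phi>' :: 'a \<Rightarrow> real).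
            prob_space \<mu> \<longrightarrow> sets \<mu> = sets borel \<longrightarrow>
            integrable \<mu> \<Phi> \<longrightarrow> integrable \<mu> \<Phi>' \<longrightarrow> essinf \<mu> \<Phi> = 0 \<longrightarrow>
              0 < normalizer \<mu> \<Phi> \<and> normalizer \<mu> \<Phi> < \<infinity> \<and> 0 < normalizer \<mu> \<Phi>' \<and>
              (essinf \<mu> \<Phi>' \<noteq> -\<infinity> \<longrightarrow> normalizer \<mu> \<Phi>' < \<infinity>) \<and>
              (normalizer \<mu> \<Phi>' < \<infinity> \<longrightarrow>
                 prob_space (gibbs \<mu> \<Phi>) \<and> prob_space (gibbs \<mu> \<Phi>') \<and>
                 ennreal (tv_dist (gibbs \<mu> \<Phi>) (gibbs \<mu> \<Phi>'))
                   \<le> exp_ereal (- min 0 (essinf \<mu> \<Phi>')) / normalizer \<mu> \<Phi>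
                      * ennreal (\<integral>x. \<bar>\<Phi> x - \<Phi>' x\<bar> \<partial>\<mu>)))
       \<and>
         (\<forall>(\<mu> :: 'a measure) (\<mu>' :: 'a measure) (\<Phi> :: 'a \<Rightarrow> real).
            prob_space \<mu> \<longrightarrow> sets \<mu> = sets borel \<longrightarrow>
            prob_space \<mu>' \<longrightarrow> sets \<mu>' = sets borel \<longrightarrow>
            \<Phi> \<in> borel_measurable borel \<longrightarrow> (\<forall>x. 0 \<le> \<Phi> x) \<longrightarrow>
              0 < normalizer \<mu> \<Phi> \<and> normalizer \<mu> \<Phi> < \<infinity> \<and>
              0 < normalizer \<mu>' \<Phi> \<and> normalizer \<mu>' \<Phi> < \<infinity> \<and>
              prob_space (gibbs \<mu> \<Phi>) \<and> prob_space (gibbs \<mu>' \<Phi>) \<and>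
              ennreal (tv_dist (gibbs \<mu> \<Phi>) (gibbs \<mu>' \<Phi>))
                \<le> 2 / normalizer \<mu> \<Phi> * ennreal (tv_dist \<mu> \<mu>'))"
proof (intro conjI allI impI, goal_cases)
  \<comment> \<open>Goals 1 to 7 come from the change of potential, goals 8 to 14 from the change of
    base measure. In each block the last goal is the bound, and the others show that the Gibbs
    measures are well defined.\<close>
  case (1 \<mu> \<Phi> \<Phi>')
  then interpret prob_space \<mu> by simp
  show ?case using 1 by (intro normalizer_pos) auto
next
  case (2 \<mu> \<Phi> \<Phi>')
  then interpret prob_space \<mu> by simp
  show ?case using essinf_AE[of \<mu> \<Phi>] 2 by (intro normalizer_finite[of 0]) auto
next
  case (3 \<mu> \<Phi> \<Phi>')
  then interpret prob_space \<mu> by simp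
  show ?case using 3 by (intro normalizer_pos) auto
next
  case (4 \<mu> \<Phi> \<Phi>')
  then interpret prob_space \<mu> by simp
  obtain m where "AE x in \<mu>. m \<le> \<Phi>' x"
    using 4 by (auto elim: min_essinf_finite)
  then show ?case by (rule normalizer_finite)
next
  case (5 \<mu> \<Phi> \<Phi>')
  then interpret prob_space \<mu> by simp
  show ?case using essinf_AE[of \<mu> \<Phi>] 5 by (intro prob_space_gibbs normalizer_finite[of 0]) auto
next
  case (6 \<mu> \<Phi> \<Phi>')
  then interpret prob_space \<mu> by simp
  show ?case using 6 by (intro prob_space_gibbs) auto
next
  case (7 \<mu> \<Phi> \<Phi>')
  then show ?case by (intro tv_dist_gibbs_potential) auto
next
  case (8 \<mu> \<mu>' \<Phi>)
  then interpret prob_space \<mu> by simp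
  show ?case using 8 by (intro normalizer_pos) auto
next
  case (9 \<mu> \<mu>' \<Phi>)
  then interpret prob_space \<mu> by simp
  show ?case using 9 by (intro normalizer_finite[of 0]) auto
next
  case (10 \<mu> \<mu>' \<Phi>)
  then interpret prob_space \<mu>' by simp
  show ?case using 10 by (intro normalizer_pos) auto
next
  case (11 \<mu> \<mu>' \<Phi>)
  then interpret prob_space \<mu>' by simp
  show ?case using 11 by (intro normalizer_finite[of 0]) auto
next
  case (12 \<mu> \<mu>' \<Phi>)
  then interpret prob_space \<mu> by simp
  show ?case using 12 by (intro prob_space_gibbs normalizer_finite[of 0]) auto
next
  case (13 \<mu> \<mu>' \<Phi>)
  then interpret prob_space \<mu>' by simp
  show ?case using 13 by (intro prob_space_gibbs normalizer_finite[of 0]) auto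
next
  case (14 \<mu> \<mu>' \<Phi>)
  then show ?case by (intro tv_dist_gibbs_prior) auto
qed

end
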